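(* The following $m$-equivalences hold: (1) $\{111,1221\}\sim\{111,2112\}$; (2) $\{112,1211\}\sim\{121,1112\}$.
   Context: A (finite, reduced) multiset is $S=1^{a_1}2^{a_2}\cdots k^{a_k}$ with $k\ge 1$ and all $a_i\ge 1$, meaning that $i$ occurs with multiplicity $a_i$. A multipermutation of $S$ is a word having exactly $a_i$ occurrences of each letter $i\in[k]=\{1,\dots,k\}$ and no other letters. A word $\pi=\pi_1\cdots\pi_n$ contains a pattern (word) $\rho=\rho_1\cdots\rho_\ell$ if there are indices $i(1)<\cdots<i(\ell)$ such that for all $a,b\in[\ell]$: $\pi_{i(a)}<\pi_{i(b)}$ iff $\rho_a<\rho_b$, and $\pi_{i(a)}>\pi_{i(b)}$ iff $\rho_a>\rho_b$; otherwise $\pi$ avoids $\rho$. For a set $P$ of patterns, $\mathrm{av}(S;P)$ is the number of multipermutations of $S$ that avoid every pattern in $P$. Two sets of patterns $P,Q$ are $m$-equivalent, written here $P\sim Q$, if $\mathrm{av}(S;P)=\mathrm{av}(S;Q)$ for every multiset $S$. *)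

theory Defs
  imports "HOL-Combinatorics.Multiset_Permutations"
begin

(* The multiset 1^(a_1) ... k^(a_k) with k >= 1 and all a_i >= 1. *)
definition reduced_mset :: "nat multiset \<Rightarrow> bool" where
  "reduced_mset S \<longleftrightarrow> (\<exists>k\<ge>1. set_mset S = {1..k})"

(* Positions in words are counted from 0. *)
definition contains_pattern :: "nat list \<Rightarrow> nat list \<Rightarrow> bool" where
  "contains_pattern \<pi> \<rho> \<longleftrightarrow>
     (\<exists>i :: nat \<Rightarrow> nat.
        strict_mono_on {..<length \<rho>} i \<and>
        (\<forall>a<length \<rho>. i a < length \<pi>) \<and>
        (\<forall>a<length \<rho>. \<forall>b<length \<rho>.
           (\<pi> ! i a < \<pi> ! i b \<longleftrightarrow> \<rho> ! a < \<rho> ! b) \<and>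
           (\<pi> ! i a > \<pi> ! i b \<longleftrightarrow> \<rho> ! a > \<rho> ! b)))"

abbreviation avoids_pattern :: "nat list \<Rightarrow> nat list \<Rightarrow> bool" where
  "avoids_pattern \<pi> \<rho> \<equiv> \<not> contains_pattern \<pi> \<rho>"

definition av :: "nat multiset \<Rightarrow> nat list set \<Rightarrow> nat" where
  "av S P = card {\<pi> \<in> permutations_of_multiset S. \<forall>\<rho>\<in>P. avoids_pattern \<pi> \<rho>}"

definition m_equivalent :: "nat list set \<Rightarrow> nat list set \<Rightarrow> bool" where
  "m_equivalent P Q \<longleftrightarrow> (\<forall>S. reduced_mset S \<longrightarrow> av S P = av S Q)"

end

theory Submission
  imports Defs "HOL-Library.Sublist" "HOL-Library.Infinite_Set"
begin

text \<open>
  For (1), only letters of multiplicity exactly 2 can take part in an occurrence of 1221 or 2112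
  when 111 is avoided. Reversing the order of these letters among themselves, and fixing all others,
  preserves the multiset and exchanges the two patterns.

  For (2), delete the smallest letter \<open>i\<close>, of multiplicity \<open>a\<close>, leaving a word of length \<open>n\<close>.
  The patterns whose letter 1 is played by \<open>i\<close> impose, on either side, no condition if \<open>a = 1\<close>,
  and that nothing larger follows the first \<open>i\<close> if \<open>a \<ge> 3\<close>. If \<open>a = 2\<close>, nothing larger may follow
  the second \<open>i\<close> on one side, or lie between the two on the other. So in both cases \<open>i\<close> can
  be inserted in \<open>n + 1\<close> ways if \<open>a \<le> 2\<close> and in one way otherwise, and induction applies.
\<close>

section \<open>Pattern containment in terms of subsequences\<close>

text \<open>Induction peels off the last chosen position: the earlier ones all lie below it, so the
  induction hypothesis is needed for the shorter prefix \<open>take (i l) xs\<close>. This is why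
  the prefix length \<open>n\<close> is kept general.\<close>

lemma subseq_map_nth_take:
  assumes "strict_mono_on {..<l} i" "\<forall>a<l. i a < n" "n \<le> length xs"
  shows "subseq (map (\<lambda>a. xs ! i a) [0..<l]) (take n xs)"
  using assms
proof (induction l arbitrary: n)
  case 0
  then show ?case by simp
next
  case (Suc l)
  have "i a < i l" if "a < l" for a
    using strict_mono_onD[OF Suc.prems(1), of a l] that by auto
  moreover have "strict_mono_on {..<l} i"
    using Suc.prems(1) by (auto simp: strict_mono_on_def)
  moreover have il: "i l < n" using Suc.prems(2) by auto
  ultimately have "subseq (map (\<lambda>a. xs ! i a) [0..<l]) (take (i l) xs)"
    using Suc.IH[of "i l"] Suc.prems(3) by auto
  then have "subseq (map (\<lambda>a. xs ! i a) [0..<Suc l]) (take (Suc (i l)) xs)"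
    using il Suc.prems(3) by (auto simp: take_Suc_conv_app_nth intro: list_emb_append_mono)
  moreover have "subseq (take (Suc (i l)) xs) (take n xs)"
    using il by (metis Suc_leI min.absorb2 prefix_imp_subseq take_is_prefix take_take min.absorb1)
  ultimately show ?case by (rule subseq_order.trans)
qed

lemma subseq_imp_strict_mono_on:
  assumes "subseq s xs"
  shows "\<exists>i. strict_mono_on {..<length s} i \<and>
             (\<forall>a<length s. i a < length xs \<and> xs ! i a = s ! a)"
  using assms
proof (induction rule: list_emb.induct)
  case (list_emb_Nil ys)
  then show ?case by (auto simp: strict_mono_on_def)
next
  case (list_emb_Cons xs ys y)
  then obtain i where "strict_mono_on {..<length xs} i"
    "\<forall>a<length xs. i a < length ys \<and> ys ! i a = xs ! a" by blast
  then show ?case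
    by (intro exI[of _ "\<lambda>a. Suc (i a)"]) (auto simp: strict_mono_on_def)
next
  case (list_emb_Cons2 x y xs ys)
  then obtain i where "strict_mono_on {..<length xs} i"
    "\<forall>a<length xs. i a < length ys \<and> ys ! i a = xs ! a" by blast
  with list_emb_Cons2(1) show ?case
    \<comment> \<open>The two heads are matched with each other, so position 0 goes to 0 and the old
      positions shift by one.\<close>
    by (intro exI[of _ "case_nat 0 (\<lambda>a. Suc (i a))"])
       (auto simp: strict_mono_on_def less_Suc_eq_0_disj split: nat.splits)
qed

text \<open>Comparing only the pairs with \<open>a < b\<close>, by cases, evaluates on concrete patterns to
  positive literals.\<close>

definition order_isomorphic :: "nat list \<Rightarrow> nat list \<Rightarrow> bool" where
  "order_isomorphic s \<rho> \<longleftrightarrow> length s = length \<rho> \<and>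
     (\<forall>b<length \<rho>. \<forall>a<b. if \<rho> ! a < \<rho> ! b then s ! a < s ! b
        else if \<rho> ! a = \<rho> ! b then s ! a = s ! b else s ! b < s ! a)"

text \<open>Only pairs in increasing position are recorded in \<open>order_isomorphic\<close>;
  trichotomy recovers the comparison for the reversed pairs.\<close>

lemma order_isomorphic_less_iff:
  assumes "order_isomorphic s \<rho>" "a < length \<rho>" "b < length \<rho>"
  shows "s ! a < s ! b \<longleftrightarrow> \<rho> ! a < \<rho> ! b"
proof (cases a b rule: linorder_cases)
  case less
  with assms show ?thesis
    unfolding order_isomorphic_def by (metis less_asym less_irrefl)
next
  case greater
  with assms show ?thesis
    unfolding order_isomorphic_def by (metis linorder_less_linear less_asym less_irrefl)
qed simp

text \<open>Trades the position function for the word \<open>s\<close> of letters it selects, so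
  that later arguments can use the calculus of \<open>subseq\<close>.\<close>

lemma contains_pattern_iff_subseq:
  "contains_pattern \<pi> \<rho> \<longleftrightarrow> (\<exists>s. subseq s \<pi> \<and> order_isomorphic s \<rho>)"
proof
  assume "contains_pattern \<pi> \<rho>"
  then obtain i where i: "strict_mono_on {..<length \<rho>} i" "\<forall>a<length \<rho>. i a < length \<pi>"
    "\<forall>a<length \<rho>. \<forall>b<length \<rho>. \<pi> ! i a < \<pi> ! i b \<longleftrightarrow> \<rho> ! a < \<rho> ! b"
    unfolding contains_pattern_def by blast
  have "order_isomorphic (map (\<lambda>a. \<pi> ! i a) [0..<length \<rho>]) \<rho>"
    unfolding order_isomorphic_def
  proof (intro conjI allI impI)
    fix a b assume "b < length \<rho>" "a < b"
    then have "a < length \<rho>" by simp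
    with \<open>b < length \<rho>\<close> i(3) show "if \<rho> ! a < \<rho> ! b
      then map (\<lambda>a. \<pi> ! i a) [0..<length \<rho>] ! a < map (\<lambda>a. \<pi> ! i a) [0..<length \<rho>] ! b
      else if \<rho> ! a = \<rho> ! b
      then map (\<lambda>a. \<pi> ! i a) [0..<length \<rho>] ! a = map (\<lambda>a. \<pi> ! i a) [0..<length \<rho>] ! b
      else map (\<lambda>a. \<pi> ! i a) [0..<length \<rho>] ! b < map (\<lambda>a. \<pi> ! i a) [0..<length \<rho>] ! a"
      by (simp add: linorder_neq_iff) (metis less_irrefl linorder_less_linear)
  qed simp
  with subseq_map_nth_take[OF i(1,2) order_refl]
  show "\<exists>s. subseq s \<pi> \<and> order_isomorphic s \<rho>" by auto
next
  assume "\<exists>s. subseq s \<pi> \<and> order_isomorphic s \<rho>"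
  then obtain s where s: "subseq s \<pi>" "order_isomorphic s \<rho>" by blast
  from subseq_imp_strict_mono_on[OF s(1)] obtain i where
    "strict_mono_on {..<length s} i" "\<forall>a<length s. i a < length \<pi> \<and> \<pi> ! i a = s ! a" by blast
  moreover have "length s = length \<rho>" using s(2) by (simp add: order_isomorphic_def)
  ultimately show "contains_pattern \<pi> \<rho>"
    unfolding contains_pattern_def
    by (intro exI[of _ i]) (simp add: order_isomorphic_less_iff[OF s(2)])
qed

lemma contains_pattern_3:
  "contains_pattern \<pi> [a,b,c] \<longleftrightarrow>
     (\<exists>x y z. subseq [x,y,z] \<pi> \<and> order_isomorphic [x,y,z] [a,b,c])"
proof -
  have "\<exists>x y z. s = [x,y,z]" if "order_isomorphic s [a,b,c]" for s
  proof -
    from that have "length s = Suc (Suc (Suc 0))" by (simp add: order_isomorphic_def)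
    then show ?thesis by (auto simp: length_Suc_conv)
  qed
  then show ?thesis unfolding contains_pattern_iff_subseq by metis
qed

lemma contains_pattern_4:
  "contains_pattern \<pi> [a,b,c,d] \<longleftrightarrow>
     (\<exists>x y z w. subseq [x,y,z,w] \<pi> \<and> order_isomorphic [x,y,z,w] [a,b,c,d])"
proof -
  have "\<exists>x y z w. s = [x,y,z,w]" if "order_isomorphic s [a,b,c,d]" for s
  proof -
    from that have "length s = Suc (Suc (Suc (Suc 0)))" by (simp add: order_isomorphic_def)
    then show ?thesis by (auto simp: length_Suc_conv)
  qed
  then show ?thesis unfolding contains_pattern_iff_subseq by metis
qed

text \<open>The bounded quantifiers over positions expand to finitely many comparisons, which turn
  equal pattern letters into equal variables. The next six lemmas follow the same scheme.\<close>

lemma contains_111: "contains_pattern \<pi> [1,1,1] \<longleftrightarrow> (\<exists>x. subseq [x,x,x] \<pi>)"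
proof -
  have "order_isomorphic [x,y,z] [1,1,1] \<longleftrightarrow> y = x \<and> z = x" for x y z
    by (simp add: order_isomorphic_def All_less_Suc) blast
  then show ?thesis unfolding contains_pattern_3 by auto
qed

lemma contains_112: "contains_pattern \<pi> [1,1,2] \<longleftrightarrow> (\<exists>x y. x < y \<and> subseq [x,x,y] \<pi>)"
proof -
  have "order_isomorphic [x,y,z] [1,1,2] \<longleftrightarrow> x < z \<and> y = x" for x y z
    by (simp add: order_isomorphic_def All_less_Suc) blast
  then show ?thesis unfolding contains_pattern_3 by auto
qed

lemma contains_121: "contains_pattern \<pi> [1,2,1] \<longleftrightarrow> (\<exists>x y. x < y \<and> subseq [x,y,x] \<pi>)"
proof -
  have "order_isomorphic [x,y,z] [1,2,1] \<longleftrightarrow> x < y \<and> z = x" for x y z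
    by (simp add: order_isomorphic_def All_less_Suc) blast
  then show ?thesis unfolding contains_pattern_3 by auto
qed

lemma contains_1221: "contains_pattern \<pi> [1,2,2,1] \<longleftrightarrow> (\<exists>x y. x < y \<and> subseq [x,y,y,x] \<pi>)"
proof -
  have "order_isomorphic [x,y,z,w] [1,2,2,1] \<longleftrightarrow> x < y \<and> z = y \<and> w = x" for x y z w
    by (simp add: order_isomorphic_def All_less_Suc) blast
  then show ?thesis unfolding contains_pattern_4 by auto
qed

lemma contains_2112: "contains_pattern \<pi> [2,1,1,2] \<longleftrightarrow> (\<exists>x y. x < y \<and> subseq [y,x,x,y] \<pi>)"
proof -
  have "order_isomorphic [x,y,z,w] [2,1,1,2] \<longleftrightarrow> y < x \<and> z = y \<and> w = x" for x y z w
    by (simp add: order_isomorphic_def All_less_Suc) blast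
  then show ?thesis unfolding contains_pattern_4 by auto
qed

lemma contains_1211: "contains_pattern \<pi> [1,2,1,1] \<longleftrightarrow> (\<exists>x y. x < y \<and> subseq [x,y,x,x] \<pi>)"
proof -
  have "order_isomorphic [x,y,z,w] [1,2,1,1] \<longleftrightarrow> x < y \<and> z = x \<and> w = x" for x y z w
    by (simp add: order_isomorphic_def All_less_Suc) blast
  then show ?thesis unfolding contains_pattern_4 by auto
qed

lemma contains_1112: "contains_pattern \<pi> [1,1,1,2] \<longleftrightarrow> (\<exists>x y. x < y \<and> subseq [x,x,x,y] \<pi>)"
proof -
  have "order_isomorphic [x,y,z,w] [1,1,1,2] \<longleftrightarrow> x < w \<and> y = x \<and> z = x" for x y z w
    by (simp add: order_isomorphic_def All_less_Suc) blast
  then show ?thesis unfolding contains_pattern_4 by auto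
qed

section \<open>Order reversal on the letters of multiplicity 2 and the first equivalence\<close>

text \<open>List \<open>D\<close> increasingly and exchange the element of each rank with the one of
  the same rank counted from the end; everything outside \<open>D\<close> stays fixed.\<close>

lemma order_reversing_involution:
  fixes D :: "nat set"
  assumes "finite D"
  obtains \<sigma> where "\<And>x. \<sigma> (\<sigma> x) = x" "\<And>x. x \<in> D \<longleftrightarrow> \<sigma> x \<in> D" "\<And>x. x \<notin> D \<Longrightarrow> \<sigma> x = x"
    "\<And>x y. x \<in> D \<Longrightarrow> y \<in> D \<Longrightarrow> x < y \<Longrightarrow> \<sigma> y < \<sigma> x"
proof -
  obtain h where h: "bij_betw h {..<card D} D" "strict_mono_on {..<card D} h"
    using ex_bij_betw_strict_mono_card[OF assms] by metis
  define g where "g = inv_into {..<card D} h"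
  have hD: "h p \<in> D" and gh: "g (h p) = p" if "p < card D" for p
    using h(1) that by (auto simp: g_def bij_betw_def inv_into_f_f)
  have gD: "g x < card D" and hg: "h (g x) = x" if "x \<in> D" for x
    using h(1) that bij_betw_inv_into[OF h(1)]
    by (auto simp: g_def bij_betw_def f_inv_into_f)
  \<comment> \<open>Here \<open>g\<close> is the rank in \<open>D\<close>. Ranks start at 0, so rank
    \<open>p\<close> is reversed to \<open>card D - Suc p\<close>.\<close>
  define \<sigma> where "\<sigma> x = (if x \<in> D then h (card D - Suc (g x)) else x)" for x
  have rev: "card D - Suc p < card D" "card D - Suc (card D - Suc p) = p"
    if "p < card D" for p using that by auto
  have mem: "x \<in> D \<longleftrightarrow> \<sigma> x \<in> D" for x
    using hD[OF rev(1)[OF gD]] by (auto simp: \<sigma>_def)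
  have "\<sigma> y < \<sigma> x" if "x \<in> D" "y \<in> D" "x < y" for x y
  proof -
    have "g x < g y"
      using that strict_mono_onD[OF h(2), of "g y" "g x"] hg gD
      by (metis lessThan_iff less_asym less_linear)
    then show ?thesis
      using that gD[OF that(1)] gD[OF that(2)]
      by (auto simp: \<sigma>_def intro!: strict_mono_onD[OF h(2)])
  qed
  moreover have "\<sigma> (\<sigma> x) = x" for x
  proof (cases "x \<in> D")
    case True
    then have "g (\<sigma> x) = card D - Suc (g x)" by (simp add: \<sigma>_def gh rev gD)
    with True mem[of x] have "\<sigma> (\<sigma> x) = h (card D - Suc (card D - Suc (g x)))"
      unfolding \<sigma>_def[of "\<sigma> x"] by simp
    with True show ?thesis by (simp add: rev(2) gD hg)
  qed (simp add: \<sigma>_def)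
  moreover have "\<sigma> x = x" if "x \<notin> D" for x using that by (simp add: \<sigma>_def)
  ultimately show ?thesis using mem that by blast
qed

lemma subseq_in_set: "subseq xs ys \<Longrightarrow> x \<in> set xs \<Longrightarrow> x \<in> set ys"
  by (induction rule: list_emb.induct) auto

lemma subseq_count_le: "subseq xs ys \<Longrightarrow> count (mset xs) x \<le> count (mset ys) x"
  by (induction rule: list_emb.induct) auto

lemma subseq_replicate: "n \<le> count (mset xs) x \<Longrightarrow> subseq (replicate n x) xs"
proof (induction xs arbitrary: n)
  case (Cons y ys)
  show ?case
  proof (cases n)
    case (Suc m)
    with Cons.prems Cons.IH[of m] Cons.IH[of n] show ?thesis by (cases "x = y") auto
  qed simp
qed simp

lemma count_image_mset_inj: "inj f \<Longrightarrow> count (image_mset f M) (f x) = count M x"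
  by (induction M) (auto dest: injD)

lemma m_equivalent_111_1221: "m_equivalent {[1,1,1], [1,2,2,1]} {[1,1,1], [2,1,1,2]}"
  unfolding m_equivalent_def
proof (intro allI impI)
  fix S :: "nat multiset"
  define D where "D = {x. count S x = 2}"
  have "D \<subseteq> set_mset S" by (auto simp: D_def simp flip: count_greater_zero_iff)
  then have "finite D" by (rule finite_subset) simp
  then obtain \<sigma> where \<sigma>: "\<And>x. \<sigma> (\<sigma> x) = x" "\<And>x. x \<in> D \<longleftrightarrow> \<sigma> x \<in> D"
      "\<And>x. x \<notin> D \<Longrightarrow> \<sigma> x = x" "\<And>x y. x \<in> D \<Longrightarrow> y \<in> D \<Longrightarrow> x < y \<Longrightarrow> \<sigma> y < \<sigma> x"
    using order_reversing_involution by blast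
  have "inj \<sigma>" by (metis \<sigma>(1) injI)
  have count_\<sigma>: "count S (\<sigma> x) = count S x" for x
    using \<sigma>(2,3) by (cases "x \<in> D") (auto simp: D_def)
  have perm: "mset (map \<sigma> \<pi>) = S" if "mset \<pi> = S" for \<pi>
  proof (rule multiset_eqI)
    fix x
    \<comment> \<open>Writing \<open>x\<close> as \<open>\<sigma> (\<sigma> x)\<close> lets
      injectivity read off its multiplicity in the image as that of \<open>\<sigma> x\<close> in
      \<open>S\<close>.\<close>
    have "count (image_mset \<sigma> S) (\<sigma> (\<sigma> x)) = count S (\<sigma> x)"
      by (rule count_image_mset_inj[OF \<open>inj \<sigma>\<close>])
    then show "count (mset (map \<sigma> \<pi>)) x = count S x" by (simp add: \<sigma>(1) count_\<sigma> that)
  qed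
  have avoid111: "\<nexists>x. subseq [x,x,x] (map \<sigma> \<pi>)" if "\<nexists>x. subseq [x,x,x] \<pi>" for \<pi>
  proof
    assume "\<exists>x. subseq [x,x,x] (map \<sigma> \<pi>)"
    then obtain x where "subseq [x,x,x] (map \<sigma> \<pi>)" ..
    from subseq_map[OF this, of \<sigma>] have "subseq [\<sigma> x,\<sigma> x,\<sigma> x] \<pi>"
      by (simp add: \<sigma>(1) o_def)
    with that show False by blast
  qed
  \<comment> \<open>Three copies of a letter would be an occurrence of 111, so multiplicity at least
    2 means exactly 2.\<close>
  have in_D: "x \<in> D" if "mset \<pi> = S" "\<nexists>x. subseq [x,x,x] \<pi>" "2 \<le> count S x" for x \<pi>
    using subseq_replicate[of 3 \<pi> x] that by (force simp: D_def numeral_3_eq_3)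
  \<comment> \<open>Each letter of an occurrence of 1221 or 2112 appears twice in it, so both
    letters lie in \<open>D\<close>. Applying \<open>\<sigma>\<close> to an occurrence in
    \<open>map \<sigma> \<pi>\<close> thus gives an occurrence of the other pattern in
    \<open>\<pi>\<close>.\<close>
  have transport: "\<sigma> y < \<sigma> x \<and> subseq (map \<sigma> s) \<pi>"
    if "mset \<pi> = S" "\<nexists>x. subseq [x,x,x] \<pi>" "subseq s (map \<sigma> \<pi>)" "x < y"
      "2 \<le> count (mset s) x" "2 \<le> count (mset s) y" for \<pi> s x y
  proof -
    have "2 \<le> count S x" "2 \<le> count S y"
      using subseq_count_le[OF that(3)] perm[OF that(1)] that(5,6) by (metis le_trans)+
    with in_D[OF that(1,2)] \<sigma>(4) \<open>x < y\<close> have "\<sigma> y < \<sigma> x" by blast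
    moreover have "subseq (map \<sigma> s) \<pi>"
      using subseq_map[OF that(3), of \<sigma>] by (simp add: \<sigma>(1) o_def)
    ultimately show ?thesis ..
  qed
  define A where "A = {\<pi>. mset \<pi> = S \<and> (\<nexists>x. subseq [x,x,x] \<pi>) \<and>
    (\<nexists>x y. x < y \<and> subseq [x,y,y,x] \<pi>)}"
  define B where "B = {\<pi>. mset \<pi> = S \<and> (\<nexists>x. subseq [x,x,x] \<pi>) \<and>
    (\<nexists>x y. x < y \<and> subseq [y,x,x,y] \<pi>)}"
  have AB: "map \<sigma> \<pi> \<in> B" if "\<pi> \<in> A" for \<pi>
  proof -
    from that have \<pi>: "mset \<pi> = S" "\<nexists>x. subseq [x,x,x] \<pi>"
      "\<nexists>x y. x < y \<and> subseq [x,y,y,x] \<pi>" by (auto simp: A_def)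
    have "\<nexists>x y. x < y \<and> subseq [y,x,x,y] (map \<sigma> \<pi>)"
      using transport[OF \<pi>(1,2), of "[y,x,x,y]" x y for x y] \<pi>(3) by fastforce
    with perm[OF \<pi>(1)] avoid111[OF \<pi>(2)] show ?thesis by (simp add: B_def)
  qed
  have BA: "map \<sigma> \<pi> \<in> A" if "\<pi> \<in> B" for \<pi>
  proof -
    from that have \<pi>: "mset \<pi> = S" "\<nexists>x. subseq [x,x,x] \<pi>"
      "\<nexists>x y. x < y \<and> subseq [y,x,x,y] \<pi>" by (auto simp: B_def)
    have "\<nexists>x y. x < y \<and> subseq [x,y,y,x] (map \<sigma> \<pi>)"
      using transport[OF \<pi>(1,2), of "[x,y,y,x]" x y for x y] \<pi>(3) by fastforce
    with perm[OF \<pi>(1)] avoid111[OF \<pi>(2)] show ?thesis by (simp add: A_def)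
  qed
  \<comment> \<open>As \<open>\<sigma>\<close> is an involution, \<open>map \<sigma>\<close> is its
    own inverse, and the two inclusions suffice.\<close>
  have "bij_betw (map \<sigma>) A B"
    by (rule bij_betw_byWitness[where f' = "map \<sigma>"]) (auto simp: \<sigma>(1) o_def AB BA)
  then have "card A = card B" by (rule bij_betw_same_card)
  moreover have "{\<pi> \<in> permutations_of_multiset S. \<forall>\<rho>\<in>{[1,1,1], [1,2,2,1]}. avoids_pattern \<pi> \<rho>} = A"
    unfolding ball_simps contains_111 contains_1221 permutations_of_multiset_def A_def by blast
  moreover have "{\<pi> \<in> permutations_of_multiset S. \<forall>\<rho>\<in>{[1,1,1], [2,1,1,2]}. avoids_pattern \<pi> \<rho>} = B"
    unfolding ball_simps contains_111 contains_2112 permutations_of_multiset_def B_def by blast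
  ultimately show "av S {[1,1,1], [1,2,2,1]} = av S {[1,1,1], [2,1,1,2]}"
    unfolding av_def by simp
qed

section \<open>Counting by deletion of the smallest letter\<close>

lemma finite_mset_eq: "finite {xs. mset xs = M}"
  using finite_permutations_of_multiset[of M] by (simp add: permutations_of_multiset_def)

text \<open>Separates the letter \<open>i\<close> from the others, so that the words on
  \<open>M\<close> can be grouped by what remains after deleting \<open>i\<close>.\<close>

lemma mset_eq_iff_filter:
  "mset xs = M \<longleftrightarrow> mset (filter (\<lambda>z. z \<noteq> i) xs) = filter_mset (\<lambda>z. z \<noteq> i) M \<and>
     count (mset xs) i = count M i"
proof
  assume *: "mset (filter (\<lambda>z. z \<noteq> i) xs) = filter_mset (\<lambda>z. z \<noteq> i) M \<and>
     count (mset xs) i = count M i"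
  show "mset xs = M"
  proof (rule multiset_eqI)
    fix x
    from * have "count (filter_mset (\<lambda>z. z \<noteq> i) (mset xs)) x = count (filter_mset (\<lambda>z. z \<noteq> i) M) x"
      by simp
    with * show "count (mset xs) x = count M x" by (cases "x = i") (simp_all only: count_filter_mset if_True simp_thms)
  qed
qed auto

text \<open>\<open>L x \<pi>\<close> is meant as "\<open>x\<close> does not play the smallest letter
  of a forbidden occurrence", which is insensitive to letters below \<open>x\<close> and holds if
  \<open>x\<close> is absent. The words on \<open>M\<close> are then the disjoint union, over the
  admissible words \<open>w\<close> without \<open>i\<close>, of the ways to insert \<open>i\<close>
  into \<open>w\<close>; all these fibres have the same size.\<close>

lemma card_local_avoiders_rec:
  fixes L :: "nat \<Rightarrow> nat list \<Rightarrow> bool" and M :: "nat multiset"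
  assumes local: "\<And>x i \<pi>. i < x \<Longrightarrow> L x \<pi> \<longleftrightarrow> L x (filter (\<lambda>z. z \<noteq> i) \<pi>)"
    and triv: "\<And>x \<pi>. x \<notin> set \<pi> \<Longrightarrow> L x \<pi>"
    and fibre: "\<And>i a w. 0 < a \<Longrightarrow> \<forall>y\<in>set w. i < y \<Longrightarrow>
       card {\<pi>. filter (\<lambda>z. z \<noteq> i) \<pi> = w \<and> count (mset \<pi>) i = a \<and> L i \<pi>} = c a (length w)"
    and min: "i \<in># M" "\<forall>y\<in>#M. i \<le> y"
  defines "N \<equiv> filter_mset (\<lambda>z. z \<noteq> i) M"
  shows "card {\<pi>. mset \<pi> = M \<and> (\<forall>x. L x \<pi>)} =
         card {\<pi>. mset \<pi> = N \<and> (\<forall>x. L x \<pi>)} * c (count M i) (size N)"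
proof -
  define W where "W = {\<pi>. mset \<pi> = N \<and> (\<forall>x. L x \<pi>)}"
  define F where "F w = {\<pi>. filter (\<lambda>z. z \<noteq> i) \<pi> = w \<and> count (mset \<pi>) i = count M i \<and> L i \<pi>}" for w
  \<comment> \<open>Letters below \<open>i\<close> do not occur in \<open>\<pi>\<close>, and letters
    up to \<open>i\<close> do not occur in the filtered word, so \<open>triv\<close> settles these
    cases. Letters above \<open>i\<close> are covered by \<open>local\<close>, and
    \<open>L i \<pi>\<close> is what remains.\<close>
  have split: "(\<forall>x. L x \<pi>) \<longleftrightarrow> (\<forall>x. L x (filter (\<lambda>z. z \<noteq> i) \<pi>)) \<and> L i \<pi>"
    if "mset \<pi> = M" for \<pi>
  proof -
    have ge: "i \<le> y" if "y \<in> set \<pi>" for y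
      using min(2) \<open>mset \<pi> = M\<close> that by auto
    have "L x \<pi>" if "x < i" for x using ge[of x] that by (intro triv) auto
    moreover have "L x (filter (\<lambda>z. z \<noteq> i) \<pi>)" if "x \<le> i" for x
      using ge[of x] that by (intro triv) auto
    ultimately show ?thesis using local by (metis linorder_le_less_linear linorder_neqE_nat)
  qed
  have "mset \<pi> = M \<and> (\<forall>x. L x \<pi>) \<longleftrightarrow>
      filter (\<lambda>z. z \<noteq> i) \<pi> \<in> W \<and> count (mset \<pi>) i = count M i \<and> L i \<pi>" for \<pi>
    using split[of \<pi>] mset_eq_iff_filter[of \<pi> M i] unfolding W_def N_def by blast
  then have "{\<pi>. mset \<pi> = M \<and> (\<forall>x. L x \<pi>)} = (\<Union>w\<in>W. F w)"
    unfolding F_def by blast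
  moreover have "card (\<Union>w\<in>W. F w) = (\<Sum>w\<in>W. card (F w))"
  proof (rule card_UN_disjoint)
    show "finite W" unfolding W_def by (rule finite_subset[OF _ finite_mset_eq[of N]]) auto
    have "F w \<subseteq> {\<pi>. mset \<pi> = M}" if "w \<in> W" for w
      using that mset_eq_iff_filter[of _ M i] by (auto simp: W_def F_def N_def)
    then show "\<forall>w\<in>W. finite (F w)" using finite_mset_eq finite_subset by metis
    show "\<forall>w\<in>W. \<forall>w'\<in>W. w \<noteq> w' \<longrightarrow> F w \<inter> F w' = {}" by (auto simp: F_def)
  qed
  moreover have "card (F w) = c (count M i) (size N)" if "w \<in> W" for w
  proof -
    have w: "mset w = N" using that by (simp add: W_def)
    have "\<forall>y\<in>set w. i < y"
    proof
      fix y assume "y \<in> set w"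
      then have "y \<in># N" using w by (metis set_mset_mset)
      with min(2) show "i < y" by (auto simp: N_def nat_less_le)
    qed
    moreover have "length w = size N" using w by (metis size_mset)
    ultimately show ?thesis using fibre[of "count M i" w i] min(1) by (simp add: F_def)
  qed
  ultimately show ?thesis by (simp add: W_def)
qed

text \<open>With a common insertion count \<open>c\<close>, both families obey the same recursion.
  The induction starts at the empty word, which satisfies both conditions because no letter occurs
  in it.\<close>

lemma card_local_avoiders_eq:
  fixes L L' :: "nat \<Rightarrow> nat list \<Rightarrow> bool" and M :: "nat multiset"
  assumes L: "\<And>x i \<pi>. i < x \<Longrightarrow> L x \<pi> \<longleftrightarrow> L x (filter (\<lambda>z. z \<noteq> i) \<pi>)"
       "\<And>x \<pi>. x \<notin> set \<pi> \<Longrightarrow> L x \<pi>"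
       "\<And>i a w. 0 < a \<Longrightarrow> \<forall>y\<in>set w. i < y \<Longrightarrow>
       card {\<pi>. filter (\<lambda>z. z \<noteq> i) \<pi> = w \<and> count (mset \<pi>) i = a \<and> L i \<pi>} = c a (length w)"
    and L': "\<And>x i \<pi>. i < x \<Longrightarrow> L' x \<pi> \<longleftrightarrow> L' x (filter (\<lambda>z. z \<noteq> i) \<pi>)"
       "\<And>x \<pi>. x \<notin> set \<pi> \<Longrightarrow> L' x \<pi>"
       "\<And>i a w. 0 < a \<Longrightarrow> \<forall>y\<in>set w. i < y \<Longrightarrow>
       card {\<pi>. filter (\<lambda>z. z \<noteq> i) \<pi> = w \<and> count (mset \<pi>) i = a \<and> L' i \<pi>} = c a (length w)"
  shows "card {\<pi>. mset \<pi> = M \<and> (\<forall>x. L x \<pi>)} = card {\<pi>. mset \<pi> = M \<and> (\<forall>x. L' x \<pi>)}"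
proof (induction M rule: measure_induct_rule[of size])
  case (less M)
  show ?case
  proof (cases "M = {#}")
    case True
    then have "{\<pi>. mset \<pi> = M \<and> (\<forall>x. L x \<pi>)} = {[]}" "{\<pi>. mset \<pi> = M \<and> (\<forall>x. L' x \<pi>)} = {[]}"
      using L(2)[of _ "[]"] L'(2)[of _ "[]"] by auto
    then show ?thesis by simp
  next
    case False
    define i where "i = Min_mset M"
    have i: "i \<in># M" "\<forall>y\<in>#M. i \<le> y" using False by (auto simp: i_def)
    define N where "N = filter_mset (\<lambda>z. z \<noteq> i) M"
    have "N \<subset># M" using i(1) unfolding N_def by (auto simp: subset_mset.less_le multiset_eq_iff)
    then have "size N < size M" by (rule mset_subset_size)
    moreover have "card {\<pi>. mset \<pi> = M \<and> (\<forall>x. L x \<pi>)} =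
        card {\<pi>. mset \<pi> = N \<and> (\<forall>x. L x \<pi>)} * c (count M i) (size N)"
      unfolding N_def by (rule card_local_avoiders_rec; fact L i)
    moreover have "card {\<pi>. mset \<pi> = M \<and> (\<forall>x. L' x \<pi>)} =
        card {\<pi>. mset \<pi> = N \<and> (\<forall>x. L' x \<pi>)} * c (count M i) (size N)"
      unfolding N_def by (rule card_local_avoiders_rec; fact L' i)
    ultimately show ?thesis using less[of N] by (simp only:)
  qed
qed

section \<open>The local conditions and the insertions of the smallest letter\<close>

text \<open>Collects the forbidden occurrences whose letter 1 is played by \<open>x\<close>;
  imposing this for every \<open>x\<close> is avoidance of both patterns. It serves as a family
  \<open>L\<close> in the recursion above.\<close>

definition no_112_1211 :: "nat \<Rightarrow> nat list \<Rightarrow> bool" where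
  "no_112_1211 x \<pi> \<longleftrightarrow> (\<forall>y>x. \<not> subseq [x,x,y] \<pi> \<and> \<not> subseq [x,y,x,x] \<pi>)"

definition no_121_1112 :: "nat \<Rightarrow> nat list \<Rightarrow> bool" where
  "no_121_1112 x \<pi> \<longleftrightarrow> (\<forall>y>x. \<not> subseq [x,y,x] \<pi> \<and> \<not> subseq [x,x,x,y] \<pi>)"

lemma subseq_filter_iff:
  assumes "\<forall>x\<in>set s. P x"
  shows "subseq s (filter P \<pi>) \<longleftrightarrow> subseq s \<pi>"
  using assms by (metis filter_True subseq_filter subseq_filter_left subseq_order.trans)

text \<open>The occurrences concerned consist of \<open>x\<close> and a larger letter, none of which
  is deleted.\<close>

lemma no_112_1211_local: "i < x \<Longrightarrow> no_112_1211 x \<pi> \<longleftrightarrow> no_112_1211 x (filter (\<lambda>z. z \<noteq> i) \<pi>)"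
  unfolding no_112_1211_def by (auto simp: subseq_filter_iff)

lemma no_121_1112_local: "i < x \<Longrightarrow> no_121_1112 x \<pi> \<longleftrightarrow> no_121_1112 x (filter (\<lambda>z. z \<noteq> i) \<pi>)"
  unfolding no_121_1112_def by (auto simp: subseq_filter_iff)

lemma no_112_1211_trivial: "x \<notin> set \<pi> \<Longrightarrow> no_112_1211 x \<pi>"
  unfolding no_112_1211_def by (metis subseq_in_set list.set_intros(1))

lemma no_121_1112_trivial: "x \<notin> set \<pi> \<Longrightarrow> no_121_1112 x \<pi>"
  unfolding no_121_1112_def by (metis subseq_in_set list.set_intros(1))

text \<open>Cut at the first \<open>i\<close>: what precedes it survives the deletion unchanged and
  is therefore a prefix of \<open>w\<close>, of length \<open>p\<close>.\<close>

lemma filter_eq_split_first: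
  assumes "filter (\<lambda>z. z \<noteq> i) \<pi> = w" "0 < count (mset \<pi>) i"
  obtains p v where "p \<le> length w" "\<pi> = take p w @ i # v"
    "filter (\<lambda>z. z \<noteq> i) v = drop p w" "count (mset \<pi>) i = Suc (count (mset v) i)"
proof -
  from assms(2) have "i \<in> set \<pi>" by simp
  then obtain u v where uv: "\<pi> = u @ i # v" "i \<notin> set u" by (meson split_list_first)
  have "filter (\<lambda>z. z \<noteq> i) u = u" using uv(2) by (auto simp: filter_id_conv)
  with assms(1) uv(1) have w: "w = u @ filter (\<lambda>z. z \<noteq> i) v" by simp
  show ?thesis
    using uv by (intro that[of "length u" v]) (auto simp: w)
qed

text \<open>Since \<open>w\<close> is free of \<open>i\<close>, the gap \<open>p\<close> is
  recovered as the length of the longest prefix without \<open>i\<close>, whatever \<open>g\<close>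
  appends. Leaving \<open>g\<close> arbitrary covers all three shapes of insertion used
  below.\<close>

lemma card_insertions:
  assumes "i \<notin> set w"
  shows "card ((\<lambda>p. take p w @ i # g p) ` {..length w}) = Suc (length w)"
proof -
  have "inj_on (\<lambda>p. take p w @ i # g p) {..length w}"
  proof (rule inj_on_inverseI)
    fix p assume "p \<in> {..length w}"
    moreover have "takeWhile (\<lambda>z. z \<noteq> i) (take p w @ i # g p) = take p w"
      using assms by (subst takeWhile_append2) (auto dest: in_set_takeD)
    ultimately show "length (takeWhile (\<lambda>z. z \<noteq> i) (take p w @ i # g p)) = p" by simp
  qed
  then show ?thesis by (simp add: card_image)
qed

lemma filter_take_drop_neq:
  "i \<notin> set w \<Longrightarrow> filter (\<lambda>z. z \<noteq> i) (take p w) = take p w"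
  "i \<notin> set w \<Longrightarrow> filter (\<lambda>z. z \<noteq> i) (drop p w) = drop p w"
  by (auto simp: filter_id_conv dest: in_set_takeD in_set_dropD)

lemma count_take_drop_eq_0:
  "i \<notin> set w \<Longrightarrow> count (mset (take p w)) i = 0"
  "i \<notin> set w \<Longrightarrow> count (mset (drop p w)) i = 0"
  by (auto dest: in_set_takeD in_set_dropD)

lemma card_fibre_1:
  assumes "i \<notin> set w"
  shows "card {\<pi>. filter (\<lambda>z. z \<noteq> i) \<pi> = w \<and> count (mset \<pi>) i = 1} = Suc (length w)"
proof -
  have "{\<pi>. filter (\<lambda>z. z \<noteq> i) \<pi> = w \<and> count (mset \<pi>) i = 1} =
        (\<lambda>p. take p w @ i # drop p w) ` {..length w}" (is "?F = ?I")
  proof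
    show "?F \<subseteq> ?I"
    proof
      fix \<pi> assume "\<pi> \<in> ?F"
      then have \<pi>: "filter (\<lambda>z. z \<noteq> i) \<pi> = w" "count (mset \<pi>) i = 1" "0 < count (mset \<pi>) i"
        by auto
      obtain p v where *: "p \<le> length w" "\<pi> = take p w @ i # v"
        "filter (\<lambda>z. z \<noteq> i) v = drop p w" "count (mset \<pi>) i = Suc (count (mset v) i)"
        by (rule filter_eq_split_first[OF \<pi>(1,3)])
      from *(4) \<pi>(2) have "filter (\<lambda>z. z \<noteq> i) v = v" by (auto simp: filter_id_conv)
      with * show "\<pi> \<in> ?I" by auto
    qed
    show "?I \<subseteq> ?F"
      using assms by (auto simp: filter_take_drop_neq count_take_drop_eq_0 simp del: count_mset_0_iff)
  qed
  then show ?thesis using card_insertions[OF assms] by simp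
qed

text \<open>All other letters are larger than \<open>i\<close>, so none may follow a copy of
  \<open>i\<close>: the only such word is \<open>w\<close> followed by all the copies.\<close>

lemma card_fibre_last:
  fixes i :: nat
  assumes "\<forall>y\<in>set w. i < y"
  shows "card {\<pi>. filter (\<lambda>z. z \<noteq> i) \<pi> = w \<and> count (mset \<pi>) i = a \<and>
           (\<forall>y>i. \<not> subseq [i,y] \<pi>)} = 1"
proof -
  have "\<pi> = w @ replicate a i"
    if "filter (\<lambda>z. z \<noteq> i) \<pi> = w" "count (mset \<pi>) i = a" "\<forall>y>i. \<not> subseq [i,y] \<pi>" for \<pi>
    using that assms
  proof (induction \<pi> arbitrary: w a)
    case (Cons x \<pi>)
    show ?case
    proof (cases "x = i")
      case True
      have "z = i" if "z \<in> set \<pi>" for z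
      proof (rule ccontr)
        assume "z \<noteq> i"
        with that Cons.prems(1,4) have "i < z" by auto
        with Cons.prems(3) True that show False by (simp add: subseq_singleton_left)
      qed
      then have \<pi>: "\<pi> = replicate (length \<pi>) i" by (simp add: replicate_eqI)
      then have "w = []" using Cons.prems(1) True by (metis (mono_tags, lifting) filter_False
        in_set_replicate set_ConsD)
      moreover have "a = Suc (length \<pi>)"
        using Cons.prems(2) True by (subst (asm) \<pi>) simp
      ultimately show ?thesis using True \<pi> by simp
    next
      case False
      with Cons.prems(1) have w: "w = x # filter (\<lambda>z. z \<noteq> i) \<pi>" by simp
      have "\<pi> = filter (\<lambda>z. z \<noteq> i) \<pi> @ replicate a i"
        using Cons.prems False w by (intro Cons.IH) auto
      with w show ?thesis by simp
    qed
  qed simp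
  moreover have "\<not> subseq [i,y] (w @ replicate a i)" if "i < y" for y
    using assms
  proof (induction w)
    case Nil
    show ?case using that by (cases a) (auto simp: subseq_singleton_left)
  qed auto
  moreover have "filter (\<lambda>z. z \<noteq> i) w = w" "count (mset w) i = 0"
    using assms by (auto simp: filter_id_conv)
  ultimately have "{\<pi>. filter (\<lambda>z. z \<noteq> i) \<pi> = w \<and> count (mset \<pi>) i = a \<and>
           (\<forall>y>i. \<not> subseq [i,y] \<pi>)} = {w @ replicate a i}"
    by (auto simp del: count_mset_0_iff)
  then show ?thesis by simp
qed

lemma subseq_Cons_append_iff: "x \<notin> set u \<Longrightarrow> subseq (x # s) (u @ v) \<longleftrightarrow> subseq (x # s) v"
  by (induction u) auto

text \<open>Cutting at the first \<open>i\<close> makes the count exact: the remaining copies lie in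
  \<open>v\<close> or \<open>v'\<close>, before or after \<open>y\<close>. The next two lemmas apply
  a pigeonhole argument to this equation.\<close>

lemma subseq_pair_split:
  assumes "subseq [i,y] \<pi>" "y \<noteq> i"
  obtains u v v' where "\<pi> = u @ [i] @ v @ [y] @ v'"
    "count (mset \<pi>) i = Suc (count (mset v) i + count (mset v') i)"
proof -
  from subseq_in_set[OF assms(1)] have "i \<in> set \<pi>" by simp
  then obtain u x where ux: "\<pi> = u @ i # x" "i \<notin> set u" by (meson split_list_first)
  with assms(1) have "subseq [i,y] (i # x)" by (simp only: subseq_Cons_append_iff[OF ux(2)])
  then have "y \<in> set x" by (simp add: subseq_singleton_left)
  then obtain v v' where "x = v @ y # v'" by (meson split_list)
  with ux assms(2) show ?thesis by (intro that[of u v v']) auto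
qed

text \<open>If \<open>y\<close> follows the first \<open>i\<close>, at least two further copies are
  distributed around \<open>y\<close>: one before it gives 112, two after it give 1211. Conversely,
  both patterns contain \<open>[i,y]\<close>.\<close>

lemma no_112_1211_iff:
  assumes "3 \<le> count (mset \<pi>) i"
  shows "no_112_1211 i \<pi> \<longleftrightarrow> (\<forall>y>i. \<not> subseq [i,y] \<pi>)"
proof
  assume L: "no_112_1211 i \<pi>"
  show "\<forall>y>i. \<not> subseq [i,y] \<pi>"
  proof (intro allI impI notI)
    fix y assume "i < y" "subseq [i,y] \<pi>"
    then obtain u v v' where \<pi>: "\<pi> = u @ [i] @ v @ [y] @ v'"
      "count (mset \<pi>) i = Suc (count (mset v) i + count (mset v') i)"
      using subseq_pair_split[of i y \<pi>] by blast
    consider "1 \<le> count (mset v) i" | "2 \<le> count (mset v') i" using assms \<pi>(2) by linarith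
    then show False
    proof cases
      case 1
      \<comment> \<open>The empty lists stand for the skipped blocks of \<open>\<pi>\<close>, so
        that the embedding is assembled block by block.\<close>
      have "subseq ([] @ [i] @ replicate 1 i @ [y] @ []) \<pi>"
        unfolding \<pi>(1) by (intro list_emb_append_mono subseq_replicate 1) auto
      with L \<open>i < y\<close> show False by (simp add: no_112_1211_def)
    next
      case 2
      have "subseq ([] @ [i] @ [] @ [y] @ replicate 2 i) \<pi>"
        unfolding \<pi>(1) by (intro list_emb_append_mono subseq_replicate 2) auto
      with L \<open>i < y\<close> show False by (simp add: no_112_1211_def numeral_2_eq_2)
    qed
  qed
next
  assume *: "\<forall>y>i. \<not> subseq [i,y] \<pi>"
  have "subseq [i,y] [i,i,y]" "subseq [i,y] [i,y,i,i]" for y by auto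
  with * show "no_112_1211 i \<pi>" unfolding no_112_1211_def by (meson subseq_order.trans)
qed

text \<open>The same pigeonhole with the thresholds exchanged: two further copies before
  \<open>y\<close> give 1112, one after it gives 121.\<close>

lemma no_121_1112_iff:
  assumes "3 \<le> count (mset \<pi>) i"
  shows "no_121_1112 i \<pi> \<longleftrightarrow> (\<forall>y>i. \<not> subseq [i,y] \<pi>)"
proof
  assume L: "no_121_1112 i \<pi>"
  show "\<forall>y>i. \<not> subseq [i,y] \<pi>"
  proof (intro allI impI notI)
    fix y assume "i < y" "subseq [i,y] \<pi>"
    then obtain u v v' where \<pi>: "\<pi> = u @ [i] @ v @ [y] @ v'"
      "count (mset \<pi>) i = Suc (count (mset v) i + count (mset v') i)"
      using subseq_pair_split[of i y \<pi>] by blast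
    consider "2 \<le> count (mset v) i" | "1 \<le> count (mset v') i" using assms \<pi>(2) by linarith
    then show False
    proof cases
      case 1
      have "subseq ([] @ [i] @ replicate 2 i @ [y] @ []) \<pi>"
        unfolding \<pi>(1) by (intro list_emb_append_mono subseq_replicate 1) auto
      with L \<open>i < y\<close> show False by (simp add: no_121_1112_def numeral_2_eq_2)
    next
      case 2
      have "subseq ([] @ [i] @ [] @ [y] @ replicate 1 i) \<pi>"
        unfolding \<pi>(1) by (intro list_emb_append_mono subseq_replicate 2) auto
      with L \<open>i < y\<close> show False by (simp add: no_121_1112_def)
    qed
  qed
next
  assume *: "\<forall>y>i. \<not> subseq [i,y] \<pi>"
  have "subseq [i,y] [i,y,i]" "subseq [i,y] [i,i,i,y]" for y by auto
  with * show "no_121_1112 i \<pi>" unfolding no_121_1112_def by (meson subseq_order.trans)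
qed

lemma filter_eq_split_two:
  assumes "filter (\<lambda>z. z \<noteq> i) \<pi> = w" "count (mset \<pi>) i = 2"
  obtains p y z where "p \<le> length w" "\<pi> = take p w @ i # y @ i # z" "drop p w = y @ z"
proof -
  have "0 < count (mset \<pi>) i" using assms(2) by linarith
  then obtain p v where p: "p \<le> length w" "\<pi> = take p w @ i # v"
    "filter (\<lambda>z. z \<noteq> i) v = drop p w" "count (mset \<pi>) i = Suc (count (mset v) i)"
    by (rule filter_eq_split_first[OF assms(1)])
  from p(4) assms(2) have "0 < count (mset v) i" by linarith
  then obtain q z where q: "q \<le> length (drop p w)" "v = take q (drop p w) @ i # z"
    "filter (\<lambda>z. z \<noteq> i) z = drop q (drop p w)" "count (mset v) i = Suc (count (mset z) i)"
    by (rule filter_eq_split_first[OF p(3)])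
  from p(4) q(4) assms(2) have "filter (\<lambda>z. z \<noteq> i) z = z" by (auto simp: filter_id_conv)
  with p q show ?thesis by (intro that[of p "take q (drop p w)" z]) (auto simp del: drop_drop)
qed

lemma subseq_count_imp_not: "count (mset \<pi>) x < count (mset s) x \<Longrightarrow> \<not> subseq s \<pi>"
  using subseq_count_le[of s \<pi> x] by auto

text \<open>1211 needs three copies of \<open>i\<close>, so only 112 matters. It forces the second
  \<open>i\<close> to the end of the word, while the first may take any gap of
  \<open>w\<close>.\<close>

lemma card_fibre_2_no_112_1211:
  assumes w: "\<forall>y\<in>set w. i < y"
  shows "card {\<pi>. filter (\<lambda>z. z \<noteq> i) \<pi> = w \<and> count (mset \<pi>) i = 2 \<and> no_112_1211 i \<pi>} =
         Suc (length w)"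
proof -
  have i: "i \<notin> set w" using w by auto
  have "{\<pi>. filter (\<lambda>z. z \<noteq> i) \<pi> = w \<and> count (mset \<pi>) i = 2 \<and> no_112_1211 i \<pi>} =
        (\<lambda>p. take p w @ i # drop p w @ [i]) ` {..length w}" (is "?F = ?I")
  proof
    show "?F \<subseteq> ?I"
    proof
      fix \<pi> assume "\<pi> \<in> ?F"
      then have \<pi>: "filter (\<lambda>z. z \<noteq> i) \<pi> = w" "count (mset \<pi>) i = 2" "no_112_1211 i \<pi>" by auto
      obtain p y z where *: "p \<le> length w" "\<pi> = take p w @ i # y @ i # z" "drop p w = y @ z"
        by (rule filter_eq_split_two[OF \<pi>(1,2)])
      have "z = []"
      proof (rule ccontr)
        assume "z \<noteq> []"
        then obtain x z' where "z = x # z'" by (cases z) auto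
        moreover from this *(3) have "x \<in> set (drop p w)" by simp
        with w have "i < x" by (meson in_set_dropD)
        moreover have "subseq ([] @ [i] @ [] @ [i] @ [x] @ []) (take p w @ [i] @ y @ [i] @ [x] @ z')"
          by (intro list_emb_append_mono) auto
        ultimately show False using \<pi>(3) *(2) by (auto simp: no_112_1211_def)
      qed
      with * show "\<pi> \<in> ?I" by auto
    qed
    show "?I \<subseteq> ?F"
    proof
      fix \<pi> assume "\<pi> \<in> ?I"
      then obtain p where \<pi>: "\<pi> = take p w @ i # drop p w @ [i]" by auto
      have i_notin: "i \<notin> set (take p w)" "i \<notin> set (drop p w)"
        using i by (auto dest: in_set_takeD in_set_dropD)
      have c: "count (mset \<pi>) i = 2"
        using i by (simp add: \<pi> count_take_drop_eq_0 del: count_mset_0_iff)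
      have "\<not> subseq [i,i,y] \<pi>" if "i < y" for y
      proof
        assume "subseq [i,i,y] \<pi>"
        \<comment> \<open>Neither \<open>take p w\<close> nor \<open>drop p w\<close> contains
          \<open>i\<close>, so the two letters \<open>i\<close> must be matched with the inserted
          copies, and nothing is left for \<open>y\<close>.\<close>
        then have "subseq [i,i,y] (i # drop p w @ [i])"
          by (simp only: \<pi> subseq_Cons_append_iff[OF i_notin(1)])
        then have "subseq [i,y] (drop p w @ [i])" by simp
        then have "subseq [i,y] [i]" by (simp only: subseq_Cons_append_iff[OF i_notin(2)])
        with that show False by simp
      qed
      moreover have "\<not> subseq [i,y,i,i] \<pi>" for y
        by (rule subseq_count_imp_not[of _ i]) (simp add: c)
      ultimately have "no_112_1211 i \<pi>" by (simp add: no_112_1211_def)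
      with c i show "\<pi> \<in> ?F" by (simp add: \<pi> filter_take_drop_neq)
    qed
  qed
  then show ?thesis using card_insertions[OF i] by simp
qed

text \<open>1112 needs three copies of \<open>i\<close>, so only 121 matters. It forces the two
  copies to be adjacent, and this block may take any gap of \<open>w\<close>.\<close>

lemma card_fibre_2_no_121_1112:
  assumes w: "\<forall>y\<in>set w. i < y"
  shows "card {\<pi>. filter (\<lambda>z. z \<noteq> i) \<pi> = w \<and> count (mset \<pi>) i = 2 \<and> no_121_1112 i \<pi>} =
         Suc (length w)"
proof -
  have i: "i \<notin> set w" using w by auto
  have "{\<pi>. filter (\<lambda>z. z \<noteq> i) \<pi> = w \<and> count (mset \<pi>) i = 2 \<and> no_121_1112 i \<pi>} =
        (\<lambda>p. take p w @ i # i # drop p w) ` {..length w}" (is "?F = ?I")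
  proof
    show "?F \<subseteq> ?I"
    proof
      fix \<pi> assume "\<pi> \<in> ?F"
      then have \<pi>: "filter (\<lambda>z. z \<noteq> i) \<pi> = w" "count (mset \<pi>) i = 2" "no_121_1112 i \<pi>" by auto
      obtain p y z where *: "p \<le> length w" "\<pi> = take p w @ i # y @ i # z" "drop p w = y @ z"
        by (rule filter_eq_split_two[OF \<pi>(1,2)])
      have "y = []"
      proof (rule ccontr)
        assume "y \<noteq> []"
        then obtain x y' where "y = x # y'" by (cases y) auto
        moreover from this *(3) have "x \<in> set (drop p w)" by simp
        with w have "i < x" by (meson in_set_dropD)
        moreover have "subseq ([] @ [i] @ [x] @ [] @ [i] @ []) (take p w @ [i] @ [x] @ y' @ [i] @ z)"
          by (intro list_emb_append_mono) auto
        ultimately show False using \<pi>(3) *(2) by (auto simp: no_121_1112_def)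
      qed
      with * show "\<pi> \<in> ?I" by auto
    qed
    show "?I \<subseteq> ?F"
    proof
      fix \<pi> assume "\<pi> \<in> ?I"
      then obtain p where \<pi>: "\<pi> = take p w @ i # i # drop p w" by auto
      have i_notin: "i \<notin> set (take p w)" "i \<notin> set (drop p w)"
        using i by (auto dest: in_set_takeD in_set_dropD)
      have c: "count (mset \<pi>) i = 2"
        using i by (simp add: \<pi> count_take_drop_eq_0 del: count_mset_0_iff)
      have "\<not> subseq [i,y,i] \<pi>" if "i < y" for y
      proof
        assume "subseq [i,y,i] \<pi>"
        then have "subseq [i,y,i] (i # i # drop p w)"
          by (simp only: \<pi> subseq_Cons_append_iff[OF i_notin(1)])
        then have "subseq [y,i] (drop p w)" using that by simp
        from subseq_in_set[OF this, of i] i show False by (auto dest: in_set_dropD)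
      qed
      moreover have "\<not> subseq [i,i,i,y] \<pi>" for y
        by (rule subseq_count_imp_not[of _ i]) (simp add: c)
      ultimately have "no_121_1112 i \<pi>" by (simp add: no_121_1112_def)
      with c i show "\<pi> \<in> ?F" by (simp add: \<pi> filter_take_drop_neq)
    qed
  qed
  then show ?thesis using card_insertions[OF i] by simp
qed

lemma card_fibre:
  assumes L: "L = no_112_1211 \<or> L = no_121_1112" and "0 < a" "\<forall>y\<in>set w. i < y"
  shows "card {\<pi>. filter (\<lambda>z. z \<noteq> i) \<pi> = w \<and> count (mset \<pi>) i = a \<and> L i \<pi>} =
         (if a \<le> 2 then Suc (length w) else 1)"
proof -
  consider "a = 1" | "a = 2" | "3 \<le> a" using assms(2) by linarith
  then show ?thesis
  proof cases
    case 1
    \<comment> \<open>Every forbidden occurrence uses \<open>i\<close> at least twice, so a single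
      copy is unconstrained.\<close>
    have "L i \<pi>" if "count (mset \<pi>) i = a" for \<pi>
    proof -
      have "\<not> subseq [i,i,y] \<pi>" "\<not> subseq [i,y,i] \<pi>" "\<not> subseq [i,y,i,i] \<pi>" "\<not> subseq [i,i,i,y] \<pi>" for y
        using that 1 by (intro subseq_count_imp_not[of _ i]; simp)+
      with L show ?thesis by (auto simp: no_112_1211_def no_121_1112_def)
    qed
    then have "{\<pi>. filter (\<lambda>z. z \<noteq> i) \<pi> = w \<and> count (mset \<pi>) i = a \<and> L i \<pi>} =
      {\<pi>. filter (\<lambda>z. z \<noteq> i) \<pi> = w \<and> count (mset \<pi>) i = 1}" using 1 by auto
    moreover have "i \<notin> set w" using assms(3) by auto
    ultimately show ?thesis using card_fibre_1[of i w] 1 by simp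
  next
    case 2
    then show ?thesis
      using L card_fibre_2_no_112_1211[OF assms(3)] card_fibre_2_no_121_1112[OF assms(3)] by auto
  next
    case 3
    then have "{\<pi>. filter (\<lambda>z. z \<noteq> i) \<pi> = w \<and> count (mset \<pi>) i = a \<and> L i \<pi>} =
      {\<pi>. filter (\<lambda>z. z \<noteq> i) \<pi> = w \<and> count (mset \<pi>) i = a \<and> (\<forall>y>i. \<not> subseq [i,y] \<pi>)}"
      using L no_112_1211_iff no_121_1112_iff by blast
    then show ?thesis using card_fibre_last[OF assms(3), of a] 3 by simp
  qed
qed

section \<open>The second equivalence\<close>

lemma m_equivalent_112_1211: "m_equivalent {[1,1,2], [1,2,1,1]} {[1,2,1], [1,1,1,2]}"
  unfolding m_equivalent_def
proof (intro allI impI)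
  fix S :: "nat multiset"
  have "card {\<pi>. mset \<pi> = S \<and> (\<forall>x. no_112_1211 x \<pi>)} =
        card {\<pi>. mset \<pi> = S \<and> (\<forall>x. no_121_1112 x \<pi>)}"
  \<comment> \<open>The witness \<open>c\<close> is the insertion count shared by both families: any
    of the \<open>n + 1\<close> gaps for one or two copies, a single way otherwise.\<close>
  proof (rule card_local_avoiders_eq[where c = "\<lambda>a n. if a \<le> 2 then Suc n else 1"])
    fix i a :: nat and w :: "nat list"
    assume a: "0 < a" and w: "\<forall>y\<in>set w. i < y"
    show "card {\<pi>. filter (\<lambda>z. z \<noteq> i) \<pi> = w \<and> count (mset \<pi>) i = a \<and> no_112_1211 i \<pi>} =
        (if a \<le> 2 then Suc (length w) else 1)"
      by (rule card_fibre[OF disjI1[OF refl] a w])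
    show "card {\<pi>. filter (\<lambda>z. z \<noteq> i) \<pi> = w \<and> count (mset \<pi>) i = a \<and> no_121_1112 i \<pi>} =
        (if a \<le> 2 then Suc (length w) else 1)"
      by (rule card_fibre[OF disjI2[OF refl] a w])
  qed (fact no_112_1211_local no_112_1211_trivial no_121_1112_local no_121_1112_trivial)+
  moreover have "{\<pi> \<in> permutations_of_multiset S. \<forall>\<rho>\<in>{[1,1,2], [1,2,1,1]}. avoids_pattern \<pi> \<rho>} =
    {\<pi>. mset \<pi> = S \<and> (\<forall>x. no_112_1211 x \<pi>)}"
    unfolding ball_simps contains_112 contains_1211 permutations_of_multiset_def no_112_1211_def
    by blast
  moreover have "{\<pi> \<in> permutations_of_multiset S. \<forall>\<rho>\<in>{[1,2,1], [1,1,1,2]}. avoids_pattern \<pi> \<rho>} =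
    {\<pi>. mset \<pi> = S \<and> (\<forall>x. no_121_1112 x \<pi>)}"
    unfolding ball_simps contains_121 contains_1112 permutations_of_multiset_def no_121_1112_def
    by blast
  ultimately show "av S {[1,1,2], [1,2,1,1]} = av S {[1,2,1], [1,1,1,2]}"
    unfolding av_def by simp
qed

theorem theorem2p10:
  shows "m_equivalent {[1,1,1], [1,2,2,1]} {[1,1,1], [2,1,1,2]} \<and>
         m_equivalent {[1,1,2], [1,2,1,1]} {[1,2,1], [1,1,1,2]}"
  using m_equivalent_111_1221 m_equivalent_112_1211 by blast

end
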